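(* Let $Z,T:L^1\to L^1$ be two positive contractions such that $TZ=ZT$. If for some $m\in\mathbb{N}\cup\{0\}$ and $k\in\mathbb{N}$ one has $\|Z(T^{m+k}-T^m)\|<2$, then for any $\varepsilon>0$ there are $d,n_0\in\mathbb{N}$ such that $$\|Z^d(T^{n+k}-T^n)\|<\varepsilon\qquad\text{for all } n\geq n_0.$$
   Context: $(X,\mathcal{F},\mu)$ is a measure space with a positive $\sigma$-additive measure $\mu$, and $L^1=L^1(X,\mathcal{F},\mu)$ is the usual (real) $L^1$ space with its usual norm and pointwise a.e. order. A linear operator $T:L^1\to L^1$ is positive if $Tf\geq 0$ whenever $f\geq 0$; it is a positive contraction if it is positive and $\|T\|\leq 1$ (operator norm). $\mathbb{N}=\{1,2,\dots\}$ and $T^0$ is the identity operator. *)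

theory Defs
  imports "HOL-Analysis.Analysis"
begin

text \<open>
  The elements of \<open>L\<^sup>1(M)\<close> are the classes of integrable real functions modulo equality
  almost everywhere. An operator on it is a function on classes; its values outside
  \<open>L1 M\<close> are never used.
\<close>

type_synonym 'a L1_elem = "('a \<Rightarrow> real) set"

definition L1_rel :: "'a measure \<Rightarrow> ('a \<Rightarrow> real) rel" where
  "L1_rel M = {(f, g). integrable M f \<and> integrable M g \<and> (AE x in M. f x = g x)}"

definition L1 :: "'a measure \<Rightarrow> 'a L1_elem set" where
  "L1 M = {f. integrable M f} // L1_rel M"

definition L1_class :: "'a measure \<Rightarrow> ('a \<Rightarrow> real) \<Rightarrow> 'a L1_elem" where
  "L1_class M f = L1_rel M `` {f}"

text \<open>
  The structure of \<open>L\<^sup>1\<close> is defined through an arbitrary representative; the lemmas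
  below show that the choice does not matter.
\<close>

definition L1_rep :: "'a L1_elem \<Rightarrow> 'a \<Rightarrow> real" where
  "L1_rep u = (SOME f. f \<in> u)"

definition L1_add :: "'a measure \<Rightarrow> 'a L1_elem \<Rightarrow> 'a L1_elem \<Rightarrow> 'a L1_elem" where
  "L1_add M u v = L1_class M (\<lambda>x. L1_rep u x + L1_rep v x)"

definition L1_diff :: "'a measure \<Rightarrow> 'a L1_elem \<Rightarrow> 'a L1_elem \<Rightarrow> 'a L1_elem" where
  "L1_diff M u v = L1_class M (\<lambda>x. L1_rep u x - L1_rep v x)"

definition L1_scale :: "'a measure \<Rightarrow> real \<Rightarrow> 'a L1_elem \<Rightarrow> 'a L1_elem" where
  "L1_scale M c u = L1_class M (\<lambda>x. c * L1_rep u x)"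

definition L1_nonneg :: "'a measure \<Rightarrow> 'a L1_elem \<Rightarrow> bool" where
  "L1_nonneg M u \<longleftrightarrow> (AE x in M. 0 \<le> L1_rep u x)"

definition L1_norm :: "'a measure \<Rightarrow> 'a L1_elem \<Rightarrow> real" where
  "L1_norm M u = (\<integral>x. \<bar>L1_rep u x\<bar> \<partial>M)"

definition L1_linear :: "'a measure \<Rightarrow> ('a L1_elem \<Rightarrow> 'a L1_elem) \<Rightarrow> bool" where
  "L1_linear M T \<longleftrightarrow>
     (\<forall>u\<in>L1 M. T u \<in> L1 M) \<and>
     (\<forall>u\<in>L1 M. \<forall>v\<in>L1 M. T (L1_add M u v) = L1_add M (T u) (T v)) \<and>
     (\<forall>c. \<forall>u\<in>L1 M. T (L1_scale M c u) = L1_scale M c (T u))"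

definition L1_positive :: "'a measure \<Rightarrow> ('a L1_elem \<Rightarrow> 'a L1_elem) \<Rightarrow> bool" where
  "L1_positive M T \<longleftrightarrow> (\<forall>u\<in>L1 M. L1_nonneg M u \<longrightarrow> L1_nonneg M (T u))"

text \<open>
  The operator norm takes values in \<^typ>\<open>ennreal\<close>, so that it is a genuine supremum
  (possibly \<open>\<infinity>\<close>) for every linear operator, bounded or not.
\<close>

definition L1_opnorm :: "'a measure \<Rightarrow> ('a L1_elem \<Rightarrow> 'a L1_elem) \<Rightarrow> ennreal" where
  "L1_opnorm M T = (SUP u\<in>{u \<in> L1 M. L1_norm M u \<le> 1}. ennreal (L1_norm M (T u)))"

definition L1_positive_contraction :: "'a measure \<Rightarrow> ('a L1_elem \<Rightarrow> 'a L1_elem) \<Rightarrow> bool" where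
  "L1_positive_contraction M T \<longleftrightarrow> L1_linear M T \<and> L1_positive M T \<and> L1_opnorm M T \<le> 1"

definition L1_opdiff ::
  "'a measure \<Rightarrow> ('a L1_elem \<Rightarrow> 'a L1_elem) \<Rightarrow> ('a L1_elem \<Rightarrow> 'a L1_elem) \<Rightarrow> 'a L1_elem \<Rightarrow> 'a L1_elem"
  where "L1_opdiff M S T = (\<lambda>u. L1_diff M (S u) (T u))"

lemma equiv_L1_rel: "equiv {f. integrable M f} (L1_rel M)"
proof (rule equivI)
  show "L1_rel M \<subseteq> {f. integrable M f} \<times> {f. integrable M f}"
    by (auto simp: L1_rel_def)
  show "refl_on {f. integrable M f} (L1_rel M)"
    by (auto simp: L1_rel_def refl_on_def)
  show "sym (L1_rel M)"
    by (auto simp: L1_rel_def sym_def eq_commute)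
  show "trans (L1_rel M)"
    unfolding L1_rel_def trans_def by (auto elim: AE_mp)
qed

lemma L1_class_in_L1: "integrable M f \<Longrightarrow> L1_class M f \<in> L1 M"
  by (simp add: L1_class_def L1_def quotientI)

lemma L1_class_eq_iff:
  assumes "integrable M f" "integrable M g"
  shows "L1_class M f = L1_class M g \<longleftrightarrow> (AE x in M. f x = g x)"
  unfolding L1_class_def
  using assms eq_equiv_class_iff[OF equiv_L1_rel, of f M g] by (auto simp: L1_rel_def)

lemma L1_rep_integrable: "u \<in> L1 M \<Longrightarrow> integrable M (L1_rep u)"
  and L1_class_rep: "u \<in> L1 M \<Longrightarrow> L1_class M (L1_rep u) = u"
proof -
  assume u: "u \<in> L1 M"
  then obtain f where f: "integrable M f" "u = L1_rel M `` {f}"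
    by (auto simp: L1_def elim: quotientE)
  then have "f \<in> u" by (auto simp: L1_rel_def)
  then have "L1_rep u \<in> u" unfolding L1_rep_def by (rule someI[of "\<lambda>f. f \<in> u"])
  then have r: "(f, L1_rep u) \<in> L1_rel M" using f by simp
  then show "integrable M (L1_rep u)" by (simp add: L1_rel_def)
  show "L1_class M (L1_rep u) = u"
    unfolding L1_class_def f(2) using equiv_class_eq[OF equiv_L1_rel r] f(2) by simp
qed

lemma AE_L1_rep_class:
  assumes "integrable M f"
  shows "AE x in M. L1_rep (L1_class M f) x = f x"
  using L1_class_eq_iff[OF L1_rep_integrable[OF L1_class_in_L1[OF assms]] assms]
    L1_class_rep[OF L1_class_in_L1[OF assms]] by simp

lemma L1_add_class:
  assumes "integrable M f" "integrable M g"
  shows "L1_add M (L1_class M f) (L1_class M g) = L1_class M (\<lambda>x. f x + g x)"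
  unfolding L1_add_def using assms AE_L1_rep_class[of M f] AE_L1_rep_class[of M g]
  by (subst L1_class_eq_iff) (auto intro: L1_rep_integrable L1_class_in_L1)

lemma L1_diff_class:
  assumes "integrable M f" "integrable M g"
  shows "L1_diff M (L1_class M f) (L1_class M g) = L1_class M (\<lambda>x. f x - g x)"
  unfolding L1_diff_def using assms AE_L1_rep_class[of M f] AE_L1_rep_class[of M g]
  by (subst L1_class_eq_iff) (auto intro: L1_rep_integrable L1_class_in_L1)

lemma L1_scale_class:
  assumes "integrable M f"
  shows "L1_scale M c (L1_class M f) = L1_class M (\<lambda>x. c * f x)"
  unfolding L1_scale_def using assms AE_L1_rep_class[of M f]
  by (subst L1_class_eq_iff) (auto intro: L1_rep_integrable L1_class_in_L1)

lemma L1_nonneg_class: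
  assumes "integrable M f"
  shows "L1_nonneg M (L1_class M f) \<longleftrightarrow> (AE x in M. 0 \<le> f x)"
  unfolding L1_nonneg_def using AE_L1_rep_class[OF assms]
  by (auto elim: AE_mp)

lemma L1_norm_class:
  assumes "integrable M f"
  shows "L1_norm M (L1_class M f) = (\<integral>x. \<bar>f x\<bar> \<partial>M)"
  unfolding L1_norm_def
proof (rule integral_cong_AE)
  show "(\<lambda>x. \<bar>L1_rep (L1_class M f) x\<bar>) \<in> borel_measurable M"
    using L1_rep_integrable[OF L1_class_in_L1[OF assms]] by auto
qed (use assms AE_L1_rep_class[OF assms] in auto)

end

theory Submission
  imports Defs
begin

text \<open>
  Why the law holds. Put \<open>U = T\<^sup>k\<close>, \<open>B = Z T\<^sup>m\<close>, \<open>P = U B = Z T\<^sup>m\<^sup>+\<^sup>k\<close> and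
  \<open>H = (I + U) / 2\<close>; these operators commute on \<open>L\<^sup>1\<close>, and the hypothesis says that
  \<open>\<parallel>P - B\<parallel> \<le> 2 q\<close> for some \<open>q < 1\<close>. For \<open>u \<ge> 0\<close> let \<open>s = min (P u) (B u)\<close> be the part
  which \<open>P u\<close> and \<open>B u\<close> share. Since \<open>P u = U (B u)\<close>, averaging the two expressions
  \<open>s + (P u - s)\<close> and \<open>U s + U (B u - s)\<close> for \<open>P u\<close> gives \<open>P u = H s + r\<close> with
  \<open>r = ((P u - s) + U (B u - s)) / 2 \<ge> 0\<close>. As the norm is additive on the positive cone,
  \<open>\<parallel>P u - s\<parallel> + \<parallel>B u - s\<parallel> = \<parallel>P u - B u\<parallel>\<close>, whence \<open>\<parallel>r\<parallel> \<le> q \<parallel>u\<parallel>\<close> and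
  \<open>\<parallel>s\<parallel> + \<parallel>r\<parallel> \<le> \<parallel>u\<parallel>\<close> (\<open>L1_splits_of_norm_diff\<close>).

  The second bound makes the splitting stable under iteration: splitting the remainder again and
  again keeps the total mass of the \<open>H\<close>-part below \<open>\<parallel>u\<parallel>\<close> while the remainder shrinks
  geometrically, so \<open>P\<^sup>n u = H s + r\<close> with \<open>\<parallel>s\<parallel> \<le> \<parallel>u\<parallel>\<close> and \<open>\<parallel>r\<parallel> \<le> q\<^sup>n \<parallel>u\<parallel>\<close>
  (\<open>L1_splits_funpow\<close>). Using this \<open>l\<close> times, now on the \<open>H\<close>-part, collects one factor
  \<open>H\<close> each time: \<open>P\<^sup>n\<^sup>l u = H\<^sup>l s + e\<close> with \<open>\<parallel>e\<parallel> \<le> l q\<^sup>n \<parallel>u\<parallel>\<close>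
  (\<open>funpow_eq_mean_power_plus_error\<close>). Finally \<open>(U - I) H\<^sup>l\<close> is small for large
  even \<open>l = 2 j\<close>: the differences of neighbouring binomial coefficients, which are its
  coefficients, telescope up to the central one and down again, and \<open>2 (2j choose j) / 4\<^sup>j\<close> tends to
  \<open>0\<close>. Choosing first \<open>l\<close> and then \<open>n\<close> large makes \<open>(U - I) P\<^sup>d\<close> small for \<open>d = n l\<close>.
  As \<open>P\<^sup>d = Z\<^sup>d T\<^sup>N\<close> for \<open>N = d (m + k)\<close>, the bound for larger powers of \<open>T\<close> follows from
  \<open>\<parallel>T\<parallel> \<le> 1\<close>.

  The splitting is carried out for one positive element at a time, and its dependence on the
  element is not linear. This avoids constructing the modulus of the operator \<open>P - B\<close>.
\<close>

section \<open>Vector lattice and norm of \<open>L\<^sup>1\<close>\<close>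

lemma L1_eqI:
  assumes "u \<in> L1 M" "v \<in> L1 M" "AE x in M. L1_rep u x = L1_rep v x"
  shows "u = v"
  using assms L1_class_eq_iff[of M "L1_rep u" "L1_rep v"]
  by (simp add: L1_rep_integrable L1_class_rep)

lemma L1_add_closed: "u \<in> L1 M \<Longrightarrow> v \<in> L1 M \<Longrightarrow> L1_add M u v \<in> L1 M"
  and L1_diff_closed: "u \<in> L1 M \<Longrightarrow> v \<in> L1 M \<Longrightarrow> L1_diff M u v \<in> L1 M"
  and L1_scale_closed: "u \<in> L1 M \<Longrightarrow> L1_scale M c u \<in> L1 M"
  unfolding L1_add_def L1_diff_def L1_scale_def
  by (auto intro!: L1_class_in_L1 L1_rep_integrable)

lemmas L1_closed = L1_add_closed L1_diff_closed L1_scale_closed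

lemma AE_rep_add:
    "u \<in> L1 M \<Longrightarrow> v \<in> L1 M \<Longrightarrow> AE x in M. L1_rep (L1_add M u v) x = L1_rep u x + L1_rep v x"
  and AE_rep_diff:
    "u \<in> L1 M \<Longrightarrow> v \<in> L1 M \<Longrightarrow> AE x in M. L1_rep (L1_diff M u v) x = L1_rep u x - L1_rep v x"
  and AE_rep_scale:
    "u \<in> L1 M \<Longrightarrow> AE x in M. L1_rep (L1_scale M c u) x = c * L1_rep u x"
  unfolding L1_add_def L1_diff_def L1_scale_def
  by (auto intro!: AE_L1_rep_class L1_rep_integrable)

lemma L1_norm_nonneg: "0 \<le> L1_norm M u"
  unfolding L1_norm_def by simp

lemma L1_norm_eqI:
  assumes "u \<in> L1 M" "integrable M g" "AE x in M. L1_rep u x = g x"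
  shows "L1_norm M u = (\<integral>x. \<bar>g x\<bar> \<partial>M)"
  unfolding L1_norm_def
  by (rule integral_cong_AE) (use assms L1_rep_integrable[OF assms(1)] in auto)

lemma L1_norm_scale: "u \<in> L1 M \<Longrightarrow> L1_norm M (L1_scale M c u) = \<bar>c\<bar> * L1_norm M u"
  by (subst L1_norm_eqI[OF _ _ AE_rep_scale])
    (auto simp: L1_closed L1_rep_integrable abs_mult L1_norm_def)

lemma L1_norm_add_le:
  assumes "u \<in> L1 M" "v \<in> L1 M"
  shows "L1_norm M (L1_add M u v) \<le> L1_norm M u + L1_norm M v"
proof -
  have "(\<integral>x. \<bar>L1_rep u x + L1_rep v x\<bar> \<partial>M) \<le> (\<integral>x. \<bar>L1_rep u x\<bar> + \<bar>L1_rep v x\<bar> \<partial>M)"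
    by (rule integral_mono) (use assms in \<open>auto intro!: L1_rep_integrable abs_triangle_ineq\<close>)
  then show ?thesis
    using assms
    by (subst L1_norm_eqI[OF _ _ AE_rep_add])
      (auto simp: L1_closed L1_rep_integrable L1_norm_def)
qed

lemma L1_norm_diff_le:
  assumes "u \<in> L1 M" "v \<in> L1 M"
  shows "L1_norm M (L1_diff M u v) \<le> L1_norm M u + L1_norm M v"
proof -
  have "(\<integral>x. \<bar>L1_rep u x - L1_rep v x\<bar> \<partial>M) \<le> (\<integral>x. \<bar>L1_rep u x\<bar> + \<bar>L1_rep v x\<bar> \<partial>M)"
    by (rule integral_mono) (use assms in \<open>auto intro!: L1_rep_integrable abs_triangle_ineq4\<close>)
  then show ?thesis
    using assms
    by (subst L1_norm_eqI[OF _ _ AE_rep_diff])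
      (auto simp: L1_closed L1_rep_integrable L1_norm_def)
qed

lemma L1_nonneg_add:
  assumes "u \<in> L1 M" "v \<in> L1 M" "L1_nonneg M u" "L1_nonneg M v"
  shows "L1_nonneg M (L1_add M u v)"
  using AE_rep_add[OF assms(1,2)] assms(3,4) unfolding L1_nonneg_def by eventually_elim simp

lemma L1_nonneg_scale:
  assumes "u \<in> L1 M" "L1_nonneg M u" "0 \<le> c"
  shows "L1_nonneg M (L1_scale M c u)"
  using AE_rep_scale[OF assms(1), of c] assms(2) unfolding L1_nonneg_def
  by eventually_elim (use assms(3) in simp)

lemma L1_norm_of_nonneg:
  assumes "u \<in> L1 M" "L1_nonneg M u"
  shows "L1_norm M u = (\<integral>x. L1_rep u x \<partial>M)"
  unfolding L1_norm_def
  by (rule integral_cong_AE)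
    (use assms L1_rep_integrable[OF assms(1)] in \<open>auto simp: L1_nonneg_def\<close>)

text \<open>
  On the positive cone the norm is the integral. This special feature of \<open>L\<^sup>1\<close> is what lets
  the splittings below account for mass exactly.
\<close>

lemma L1_norm_add_nonneg:
  assumes "u \<in> L1 M" "v \<in> L1 M" "L1_nonneg M u" "L1_nonneg M v"
  shows "L1_norm M (L1_add M u v) = L1_norm M u + L1_norm M v"
proof -
  have "L1_norm M (L1_add M u v) = (\<integral>x. L1_rep (L1_add M u v) x \<partial>M)"
    using assms by (intro L1_norm_of_nonneg L1_nonneg_add L1_closed)
  also have "\<dots> = (\<integral>x. L1_rep u x + L1_rep v x \<partial>M)"
    by (rule integral_cong_AE)
      (use assms L1_rep_integrable[OF assms(1)] L1_rep_integrable[OF assms(2)]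
         L1_rep_integrable[OF L1_add_closed[OF assms(1,2)]] AE_rep_add[OF assms(1,2)] in auto)
  finally show ?thesis
    using assms by (simp add: L1_norm_of_nonneg L1_rep_integrable)
qed

text \<open>
  Positive and negative part have disjoint supports. Since their norms add up exactly, operator
  bounds need only be checked on the positive cone.
\<close>

lemma L1_decompose:
  assumes "u \<in> L1 M"
  obtains v w where "v \<in> L1 M" "w \<in> L1 M" "L1_nonneg M v" "L1_nonneg M w"
    "u = L1_diff M v w" "L1_norm M u = L1_norm M v + L1_norm M w"
proof -
  let ?f = "L1_rep u"
  let ?p = "\<lambda>x. max (?f x) 0" and ?n = "\<lambda>x. max (- ?f x) 0"
  have f: "integrable M ?f" using assms by (rule L1_rep_integrable)
  then have i: "integrable M ?p" "integrable M ?n" by auto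
  have "(\<lambda>x. ?p x - ?n x) = ?f" by auto
  then have "u = L1_class M (\<lambda>x. ?p x - ?n x)"
    using L1_class_rep[OF assms] by simp
  then have d: "u = L1_diff M (L1_class M ?p) (L1_class M ?n)"
    using i by (simp add: L1_diff_class)
  have "L1_norm M u = (\<integral>x. \<bar>?p x\<bar> + \<bar>?n x\<bar> \<partial>M)"
    unfolding L1_norm_def by (rule Bochner_Integration.integral_cong) auto
  also have "\<dots> = L1_norm M (L1_class M ?p) + L1_norm M (L1_class M ?n)"
    using i by (simp add: L1_norm_class)
  finally show ?thesis
    using that[of "L1_class M ?p" "L1_class M ?n"] d i
    by (simp add: L1_class_in_L1 L1_nonneg_class)
qed

section \<open>Linear operators and their norm\<close>

lemma L1_linearD:
  assumes "L1_linear M T"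
  shows L1_linear_closed: "u \<in> L1 M \<Longrightarrow> T u \<in> L1 M"
    and L1_linear_add: "u \<in> L1 M \<Longrightarrow> v \<in> L1 M \<Longrightarrow> T (L1_add M u v) = L1_add M (T u) (T v)"
    and L1_linear_scale: "u \<in> L1 M \<Longrightarrow> T (L1_scale M c u) = L1_scale M c (T u)"
  using assms unfolding L1_linear_def by auto

lemma L1_diff_conv_add:
  assumes "u \<in> L1 M" "v \<in> L1 M"
  shows "L1_diff M u v = L1_add M u (L1_scale M (-1) v)"
proof (rule L1_eqI)
  show "AE x in M. L1_rep (L1_diff M u v) x = L1_rep (L1_add M u (L1_scale M (-1) v)) x"
    using AE_rep_diff[OF assms] AE_rep_add[OF assms(1) L1_scale_closed[OF assms(2), of "-1"]]
      AE_rep_scale[OF assms(2), of "-1"] by eventually_elim simp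
qed (use assms in \<open>auto intro!: L1_closed\<close>)

lemma L1_linear_diff:
  assumes "L1_linear M T" "u \<in> L1 M" "v \<in> L1 M"
  shows "T (L1_diff M u v) = L1_diff M (T u) (T v)"
  using assms by (simp add: L1_diff_conv_add L1_linear_add L1_linear_scale L1_linear_closed L1_closed)

lemma L1_linear_comp: "L1_linear M S \<Longrightarrow> L1_linear M T \<Longrightarrow> L1_linear M (S \<circ> T)"
  unfolding L1_linear_def by auto

lemma L1_add_diff_swap:
  assumes "a \<in> L1 M" "b \<in> L1 M" "c \<in> L1 M" "d \<in> L1 M"
  shows "L1_diff M (L1_add M a b) (L1_add M c d) = L1_add M (L1_diff M a c) (L1_diff M b d)"
proof (rule L1_eqI)
  show "AE x in M. L1_rep (L1_diff M (L1_add M a b) (L1_add M c d)) x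
      = L1_rep (L1_add M (L1_diff M a c) (L1_diff M b d)) x"
    using AE_rep_diff[OF L1_add_closed[OF assms(1,2)] L1_add_closed[OF assms(3,4)]]
      AE_rep_add[OF L1_diff_closed[OF assms(1,3)] L1_diff_closed[OF assms(2,4)]]
      AE_rep_add[OF assms(1,2)] AE_rep_add[OF assms(3,4)]
      AE_rep_diff[OF assms(1,3)] AE_rep_diff[OF assms(2,4)]
    by eventually_elim simp
qed (use assms in \<open>auto intro!: L1_closed\<close>)

lemma L1_linear_opdiff:
  assumes "L1_linear M S" "L1_linear M T"
  shows "L1_linear M (L1_opdiff M S T)"
  unfolding L1_linear_def
proof (intro conjI ballI allI)
  fix u v and c :: real
  assume u: "u \<in> L1 M" 
  note S = L1_linearD[OF assms(1)] and T = L1_linearD[OF assms(2)]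
  show "L1_opdiff M S T u \<in> L1 M"
    using u S T by (simp add: L1_opdiff_def L1_closed)
  show "L1_opdiff M S T (L1_scale M c u) = L1_scale M c (L1_opdiff M S T u)"
  proof (rule L1_eqI)
    show "AE x in M. L1_rep (L1_opdiff M S T (L1_scale M c u)) x =
        L1_rep (L1_scale M c (L1_opdiff M S T u)) x"
      unfolding L1_opdiff_def S(3)[OF u] T(3)[OF u]
      using AE_rep_diff[OF L1_scale_closed[OF S(1)[OF u], of c] L1_scale_closed[OF T(1)[OF u], of c]]
        AE_rep_scale[OF L1_diff_closed[OF S(1)[OF u] T(1)[OF u]], of c]
        AE_rep_diff[OF S(1)[OF u] T(1)[OF u]]
        AE_rep_scale[OF S(1)[OF u], of c] AE_rep_scale[OF T(1)[OF u], of c]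
      by eventually_elim (simp add: algebra_simps)
  qed (use u S T in \<open>auto simp: L1_opdiff_def L1_closed\<close>)
  assume v: "v \<in> L1 M"
  show "L1_opdiff M S T (L1_add M u v) = L1_add M (L1_opdiff M S T u) (L1_opdiff M S T v)"
    using u v S T by (simp add: L1_opdiff_def L1_add_diff_swap)
qed

text \<open>
  Scaling to the unit ball handles every element of nonzero norm. An element of norm zero is the
  zero class, and there homogeneity takes over.
\<close>

lemma L1_norm_le_of_opnorm_le:
  assumes T: "L1_linear M T" and c: "L1_opnorm M T \<le> ennreal c" "0 \<le> c" and u: "u \<in> L1 M"
  shows "L1_norm M (T u) \<le> c * L1_norm M u"
proof -
  note lin = L1_linearD[OF T]
  have unit: "L1_norm M (T v) \<le> c" if "v \<in> L1 M" "L1_norm M v \<le> 1" for v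
  proof -
    have "ennreal (L1_norm M (T v)) \<le> L1_opnorm M T"
      unfolding L1_opnorm_def by (rule SUP_upper) (use that in simp)
    with c show ?thesis by (metis ennreal_le_iff order_trans)
  qed
  show ?thesis
  proof (cases "L1_norm M u = 0")
    case True
    then have "AE x in M. L1_rep u x = 0"
      unfolding L1_norm_def
      using integral_nonneg_eq_0_iff_AE[of M "\<lambda>x. \<bar>L1_rep u x\<bar>"] L1_rep_integrable[OF u] by simp
    then have "u = L1_scale M 0 u"
      using AE_rep_scale[OF u, of 0] by (intro L1_eqI) (auto simp: u L1_closed)
    then have "T u = L1_scale M 0 (T u)" using lin(3)[OF u, of 0] by simp
    then have "L1_norm M (T u) = 0" using L1_norm_scale[OF lin(1)[OF u], of 0] by simp
    then show ?thesis using True by simp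
  next
    case False
    then have pos: "0 < L1_norm M u" using L1_norm_nonneg[of M u] by simp
    let ?v = "L1_scale M (1 / L1_norm M u) u"
    have "L1_norm M (T ?v) \<le> c"
      using pos by (intro unit) (auto simp: L1_norm_scale u L1_closed)
    then show ?thesis
      using pos by (simp add: lin(3)[OF u] L1_norm_scale lin(1)[OF u] field_simps)
  qed
qed

lemma L1_opnorm_leI:
  assumes "\<And>u. u \<in> L1 M \<Longrightarrow> L1_norm M (T u) \<le> c * L1_norm M u" "0 \<le> c"
  shows "L1_opnorm M T \<le> ennreal c"
  unfolding L1_opnorm_def
proof (rule SUP_least)
  fix u assume "u \<in> {u \<in> L1 M. L1_norm M u \<le> 1}"
  then have u: "u \<in> L1 M" "L1_norm M u \<le> 1" by auto
  have "L1_norm M (T u) \<le> c * L1_norm M u" by (rule assms(1)[OF u(1)])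
  also have "\<dots> \<le> c" using u(2) assms(2) by (simp add: mult_left_le)
  finally show "ennreal (L1_norm M (T u)) \<le> ennreal c" by (rule ennreal_leI)
qed

lemma L1_norm_le_of_nonneg:
  assumes T: "L1_linear M T" and u: "u \<in> L1 M"
    and pos: "\<And>v. v \<in> L1 M \<Longrightarrow> L1_nonneg M v \<Longrightarrow> L1_norm M (T v) \<le> c * L1_norm M v"
  shows "L1_norm M (T u) \<le> c * L1_norm M u"
proof -
  obtain v w where vw: "v \<in> L1 M" "w \<in> L1 M" "L1_nonneg M v" "L1_nonneg M w"
    "u = L1_diff M v w" "L1_norm M u = L1_norm M v + L1_norm M w"
    using L1_decompose[OF u] by blast
  have "L1_norm M (T u) \<le> L1_norm M (T v) + L1_norm M (T w)"
    unfolding vw(5) L1_linear_diff[OF T vw(1,2)]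
    by (intro L1_norm_diff_le L1_linear_closed[OF T] vw)
  also have "\<dots> \<le> c * L1_norm M v + c * L1_norm M w"
    by (intro add_mono pos vw)
  finally show ?thesis by (simp add: vw(6) algebra_simps)
qed

section \<open>Positive contractions\<close>

lemma L1_positive_contractionD:
  assumes "L1_positive_contraction M T"
  shows pc_linear: "L1_linear M T"
    and pc_closed: "u \<in> L1 M \<Longrightarrow> T u \<in> L1 M"
    and pc_add: "u \<in> L1 M \<Longrightarrow> v \<in> L1 M \<Longrightarrow> T (L1_add M u v) = L1_add M (T u) (T v)"
    and pc_scale: "u \<in> L1 M \<Longrightarrow> T (L1_scale M c u) = L1_scale M c (T u)"
    and pc_diff: "u \<in> L1 M \<Longrightarrow> v \<in> L1 M \<Longrightarrow> T (L1_diff M u v) = L1_diff M (T u) (T v)"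
    and pc_nonneg: "u \<in> L1 M \<Longrightarrow> L1_nonneg M u \<Longrightarrow> L1_nonneg M (T u)"
    and pc_norm: "u \<in> L1 M \<Longrightarrow> L1_norm M (T u) \<le> L1_norm M u"
proof -
  have T: "L1_linear M T" "L1_positive M T" "L1_opnorm M T \<le> ennreal 1"
    using assms by (auto simp: L1_positive_contraction_def)
  show "L1_linear M T" by (rule T)
  show "u \<in> L1 M \<Longrightarrow> T u \<in> L1 M" by (rule L1_linear_closed[OF T(1)])
  show "u \<in> L1 M \<Longrightarrow> v \<in> L1 M \<Longrightarrow> T (L1_add M u v) = L1_add M (T u) (T v)"
    by (rule L1_linear_add[OF T(1)])
  show "u \<in> L1 M \<Longrightarrow> T (L1_scale M c u) = L1_scale M c (T u)"
    by (rule L1_linear_scale[OF T(1)])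
  show "u \<in> L1 M \<Longrightarrow> v \<in> L1 M \<Longrightarrow> T (L1_diff M u v) = L1_diff M (T u) (T v)"
    by (rule L1_linear_diff[OF T(1)])
  show "u \<in> L1 M \<Longrightarrow> L1_nonneg M u \<Longrightarrow> L1_nonneg M (T u)"
    using T(2) by (simp add: L1_positive_def)
  show "u \<in> L1 M \<Longrightarrow> L1_norm M (T u) \<le> L1_norm M u"
    using L1_norm_le_of_opnorm_le[OF T(1,3), of u] by simp
qed

lemma L1_positive_contractionI:
  assumes "L1_linear M T"
    and "\<And>u. u \<in> L1 M \<Longrightarrow> L1_nonneg M u \<Longrightarrow> L1_nonneg M (T u)"
    and "\<And>u. u \<in> L1 M \<Longrightarrow> L1_norm M (T u) \<le> L1_norm M u"
  shows "L1_positive_contraction M T"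
  using assms L1_opnorm_leI[of M T 1]
  by (auto simp: L1_positive_contraction_def L1_positive_def)

lemma pc_comp:
  assumes "L1_positive_contraction M S" "L1_positive_contraction M T"
  shows "L1_positive_contraction M (S \<circ> T)"
proof (rule L1_positive_contractionI)
  note S = L1_positive_contractionD[OF assms(1)] and T = L1_positive_contractionD[OF assms(2)]
  show "L1_linear M (S \<circ> T)" by (rule L1_linear_comp[OF S(1) T(1)])
  show "L1_nonneg M ((S \<circ> T) u)" if "u \<in> L1 M" "L1_nonneg M u" for u
    using S(6)[OF T(2)[OF that(1)] T(6)[OF that]] by simp
  show "L1_norm M ((S \<circ> T) u) \<le> L1_norm M u" if "u \<in> L1 M" for u
    using S(7)[OF T(2)[OF that]] T(7)[OF that] by simp
qed

lemma pc_funpow: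
  assumes "L1_positive_contraction M T"
  shows "L1_positive_contraction M (T ^^ n)"
proof (induction n)
  case 0
  show ?case by (rule L1_positive_contractionI) (auto simp: L1_linear_def)
next
  case (Suc n)
  then have "L1_positive_contraction M (T \<circ> T ^^ n)" by (rule pc_comp[OF assms])
  then show ?case by (simp only: funpow.simps)
qed

definition L1_mean :: "'a measure \<Rightarrow> ('a L1_elem \<Rightarrow> 'a L1_elem) \<Rightarrow> 'a L1_elem \<Rightarrow> 'a L1_elem" where
  "L1_mean M U u = L1_scale M (1/2) (L1_add M u (U u))"

lemma AE_rep_mean:
  assumes "u \<in> L1 M" "U u \<in> L1 M"
  shows "AE x in M. L1_rep (L1_mean M U u) x = (L1_rep u x + L1_rep (U u) x) / 2"
  unfolding L1_mean_def
  using AE_rep_scale[OF L1_add_closed[OF assms], of "1/2"] AE_rep_add[OF assms]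
  by eventually_elim simp

lemma pc_mean:
  assumes U: "L1_positive_contraction M U"
  shows "L1_positive_contraction M (L1_mean M U)"
proof (rule L1_positive_contractionI)
  note cl = pc_closed[OF U]
  show "L1_nonneg M (L1_mean M U u)" if "u \<in> L1 M" "L1_nonneg M u" for u
    unfolding L1_mean_def using that U
    by (intro L1_nonneg_scale L1_nonneg_add L1_closed) (auto simp: pc_closed pc_nonneg)
  show "L1_norm M (L1_mean M U u) \<le> L1_norm M u" if "u \<in> L1 M" for u
    using L1_norm_add_le[OF that cl[OF that]] pc_norm[OF U that]
    by (simp add: L1_mean_def L1_norm_scale L1_closed that cl)
  show "L1_linear M (L1_mean M U)"
    unfolding L1_linear_def
  proof (intro conjI ballI allI)
    fix u v and c :: real
    assume u: "u \<in> L1 M"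
    show c0: "L1_mean M U u \<in> L1 M" using u cl by (simp add: L1_mean_def L1_closed)
    show "L1_mean M U (L1_scale M c u) = L1_scale M c (L1_mean M U u)"
    proof (rule L1_eqI)
      show "AE x in M. L1_rep (L1_mean M U (L1_scale M c u)) x =
          L1_rep (L1_scale M c (L1_mean M U u)) x"
        using AE_rep_mean[where U = U, OF L1_scale_closed[OF u, of c] cl[OF L1_scale_closed[OF u, of c]]]
          AE_rep_scale[OF c0, of c] AE_rep_mean[where U = U, OF u cl[OF u]] AE_rep_scale[OF u, of c]
          AE_rep_scale[OF cl[OF u], of c]
        unfolding pc_scale[OF U u] by eventually_elim (simp add: add_divide_distrib distrib_left)
    qed (use u cl in \<open>auto simp: L1_mean_def L1_closed\<close>)
    assume v: "v \<in> L1 M"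
    then have c1: "L1_mean M U v \<in> L1 M" using cl by (simp add: L1_mean_def L1_closed)
    show "L1_mean M U (L1_add M u v) = L1_add M (L1_mean M U u) (L1_mean M U v)"
    proof (rule L1_eqI)
      show "AE x in M. L1_rep (L1_mean M U (L1_add M u v)) x =
          L1_rep (L1_add M (L1_mean M U u) (L1_mean M U v)) x"
        using AE_rep_mean[where U = U, OF L1_add_closed[OF u v] cl[OF L1_add_closed[OF u v]]]
          AE_rep_add[OF c0 c1] AE_rep_mean[where U = U, OF u cl[OF u]] AE_rep_mean[where U = U, OF v cl[OF v]]
          AE_rep_add[OF u v] AE_rep_add[OF cl[OF u] cl[OF v]]
        unfolding pc_add[OF U u v] by eventually_elim (simp add: add_divide_distrib distrib_left)
    qed (use u v cl in \<open>auto simp: L1_mean_def L1_closed\<close>)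
  qed
qed

lemma pc_mean_commute:
  assumes P: "L1_positive_contraction M P" and U: "L1_positive_contraction M U"
    and "\<forall>u\<in>L1 M. P (U u) = U (P u)" "u \<in> L1 M"
  shows "P (L1_mean M U u) = L1_mean M U (P u)"
  using assms by (simp add: L1_mean_def pc_scale[OF P] pc_add[OF P] pc_closed[OF U] L1_closed)

lemma funpow_commute_on:
  assumes "\<forall>u\<in>S. f u \<in> S" "\<forall>u\<in>S. f (g u) = g (f u)" "u \<in> S"
  shows "(f ^^ n) (g u) = g ((f ^^ n) u)"
proof -
  have "(f ^^ n) u \<in> S \<and> (f ^^ n) (g u) = g ((f ^^ n) u)"
    using assms by (induction n) auto
  then show ?thesis ..
qed

section \<open>Binomial averages\<close>

lemma sum_binomial_Suc:
  fixes x :: "nat \<Rightarrow> real"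
  shows "(\<Sum>j\<le>Suc l. real (Suc l choose j) * x j)
    = (\<Sum>j\<le>l. real (l choose j) * x j) + (\<Sum>j\<le>l. real (l choose j) * x (Suc j))"
proof -
  have "(\<Sum>j\<le>Suc l. real (l choose j) * x j) = (\<Sum>j\<le>l. real (l choose j) * x j)"
    by simp
  then have "(\<Sum>j\<le>l. real (l choose j) * x j)
      = x 0 + (\<Sum>j\<le>l. real (l choose Suc j) * x (Suc j))"
    by (simp only: sum.atMost_Suc_shift) simp
  then show ?thesis
    by (simp only: sum.atMost_Suc_shift) (simp add: sum.distrib distrib_right)
qed

lemma sum_by_parts:
  fixes c x :: "nat \<Rightarrow> real"
  shows "(\<Sum>j\<le>l. c j * x j) - (\<Sum>j\<le>l. c j * x (Suc j))
    = c 0 * x 0 + (\<Sum>j\<le>l. (c (Suc j) - c j) * x (Suc j)) - c (Suc l) * x (Suc l)"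
  by (induction l) (auto simp: algebra_simps)

text \<open>
  The even rows of Pascal's triangle increase up to the middle and decrease afterwards, so the
  sum telescopes on each half. The term \<open>j = 2 n\<close> contributes the final step down to \<open>0\<close>,
  whereas the initial step up to \<open>1\<close> is absent; hence the \<open>- 1\<close>.
\<close>

lemma sum_abs_diff_binomial:
  "(\<Sum>j\<le>2*n. \<bar>real (2*n choose Suc j) - real (2*n choose j)\<bar>) = 2 * real (2*n choose n) - 1"
proof -
  let ?c = "\<lambda>j. real (2*n choose j)"
  have "(\<Sum>j<2*n+1. \<bar>?c (Suc j) - ?c j\<bar>)
      = (\<Sum>j<n. \<bar>?c (Suc j) - ?c j\<bar>) + (\<Sum>j=n..<2*n+1. \<bar>?c (Suc j) - ?c j\<bar>)"
    by (subst sum.atLeastLessThan_concat[of 0 n "2*n+1", symmetric, simplified lessThan_atLeast0[symmetric]])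
       (auto simp: lessThan_atLeast0)
  also have "(\<Sum>j<n. \<bar>?c (Suc j) - ?c j\<bar>) = (\<Sum>j<n. ?c (Suc j) - ?c j)"
  proof (rule sum.cong)
    fix j assume "j \<in> {..<n}"
    then have "(2*n choose j) \<le> (2*n choose Suc j)" by (intro binomial_mono) auto
    then show "\<bar>?c (Suc j) - ?c j\<bar> = ?c (Suc j) - ?c j" by simp
  qed simp
  also have "\<dots> = ?c n - 1" by (subst sum_lessThan_telescope) simp
  also have "(\<Sum>j=n..<2*n+1. \<bar>?c (Suc j) - ?c j\<bar>) = (\<Sum>j=n..<2*n+1. - (?c (Suc j) - ?c j))"
  proof (rule sum.cong)
    fix j assume "j \<in> {n..<2*n+1}"
    then have "(2*n choose Suc j) \<le> (2*n choose j)"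
      by (cases "j = 2*n") (auto intro!: binomial_antimono simp: binomial_eq_0)
    then show "\<bar>?c (Suc j) - ?c j\<bar> = - (?c (Suc j) - ?c j)" by simp
  qed simp
  also have "\<dots> = ?c n"
    by (subst sum_negf, subst sum_Suc_diff') auto
  finally show ?thesis by (simp add: lessThan_Suc_atMost[symmetric])
qed

lemma central_binomial_Suc:
  "real (2 * Suc n choose Suc n) * (real n + 1) = 2 * (2 * real n + 1) * real (2 * n choose n)"
proof -
  have "(2 * Suc n choose Suc n) * Suc n = Suc (2 * n + 1) * (2 * n + 1 choose n)"
    using Suc_times_binomial_eq[of "2 * n + 1" n] by simp
  also have "(2 * n + 1 choose n) = (2 * n + 1 choose Suc n)"
    using binomial_symmetric[of n "2 * n + 1"] by simp
  also have "Suc (2 * n + 1) * (2 * n + 1 choose Suc n) = 2 * ((Suc (2 * n) choose Suc n) * Suc n)"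
    by (simp add: algebra_simps)
  also have "(Suc (2 * n) choose Suc n) * Suc n = Suc (2 * n) * (2 * n choose n)"
    using Suc_times_binomial_eq[of "2 * n" n] by simp
  finally have "real ((2 * Suc n choose Suc n) * Suc n) = real (2 * (Suc (2 * n) * (2 * n choose n)))"
    by (rule arg_cong)
  then show ?thesis by (simp add: algebra_simps)
qed

text \<open>
  The Wallis-type bound. Passing from \<open>n\<close> to \<open>n + 1\<close> multiplies the left side by
  \<open>(2 n + 1) (2 n + 3) / (2 n + 2)\<^sup>2\<close>, which is below \<open>1\<close>.
\<close>

lemma central_binomial_square_le:
  "(real (2*n choose n) / 4 ^ n)\<^sup>2 * (2 * real n + 1) \<le> 1"
proof (induction n)
  case 0
  show ?case by simp
next
  case (Suc n)
  let ?a = "\<lambda>n. real (2*n choose n) / 4 ^ n"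
  have "?a (Suc n) = ?a n * ((2 * real n + 1) / (2 * real n + 2))"
  proof -
    have "y / 4 ^ Suc n = x / 4 ^ n * ((2 * real n + 1) / (2 * real n + 2))"
      if "y * (real n + 1) = 2 * (2 * real n + 1) * x" for x y :: real
    proof -
      have "y = 2 * (2 * real n + 1) * x / (real n + 1)"
        using that by (simp add: eq_divide_eq)
      moreover have "2 * w * x / z / (4 * p) = x / p * (w / (2 * z))" for w z p :: real
        by (simp add: mult.commute)
      moreover have "2 * real n + 2 = 2 * (real n + 1)" by simp
      ultimately show ?thesis by (simp only: power_Suc)
    qed
    from this[OF central_binomial_Suc] show ?thesis .
  qed
  then have "(?a (Suc n))\<^sup>2 * (2 * real (Suc n) + 1)
      = (?a n)\<^sup>2 * (2 * real n + 1) * ((2 * real n + 1) * (2 * real n + 3) / (2 * real n + 2)\<^sup>2)"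
    by (simp add: power2_eq_square power_divide algebra_simps del: binomial_Suc_Suc mult_Suc_right)
  also have "\<dots> \<le> 1 * 1"
  proof (rule mult_mono)
    show "(2 * real n + 1) * (2 * real n + 3) / (2 * real n + 2)\<^sup>2 \<le> 1"
    proof -
      have "(2 * real n + 1) * (2 * real n + 3) \<le> (2 * real n + 2)\<^sup>2"
        by (simp add: power2_eq_square algebra_simps)
      moreover have "0 < (2 * real n + 2)\<^sup>2" by (simp add: add_nonneg_pos)
      ultimately show ?thesis by (simp only: divide_le_eq_1_pos)
    qed
  qed (use Suc.IH in auto)
  finally show ?case by simp
qed

lemma central_binomial_tendsto_0: "(\<lambda>n. real (2*n choose n) / 4 ^ n) \<longlonglongrightarrow> 0"
proof -
  have "(\<lambda>n. (real (2*n choose n) / 4 ^ n)\<^sup>2) \<longlonglongrightarrow> 0"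
  proof (rule tendsto_sandwich[where f = "\<lambda>_. 0"])
    show "\<forall>\<^sub>F n in sequentially. (real (2*n choose n) / 4 ^ n)\<^sup>2 \<le> 1 / (real n + 1)"
    proof (rule always_eventually, rule allI)
      fix n
      have "(real (2*n choose n) / 4 ^ n)\<^sup>2 * (real n + 1)
          \<le> (real (2*n choose n) / 4 ^ n)\<^sup>2 * (2 * real n + 1)"
        by (intro mult_left_mono) auto
      also have "\<dots> \<le> 1" by (rule central_binomial_square_le)
      finally show "(real (2*n choose n) / 4 ^ n)\<^sup>2 \<le> 1 / (real n + 1)"
        by (simp add: pos_le_divide_eq del: power_divide)
    qed
    show "(\<lambda>n. 1 / (real n + 1)) \<longlonglongrightarrow> 0"
      using LIMSEQ_inverse_real_of_nat by (simp add: inverse_eq_divide add.commute)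
  qed auto
  then show ?thesis by (simp only: power_tendsto_0_iff zero_less_numeral)
qed

text \<open>
  The binomial expansion of \<open>H\<^sup>l = ((I + U) / 2)\<^sup>l\<close>, stated for representatives so that the sums
  are sums of real numbers.
\<close>

lemma AE_rep_funpow_mean:
  assumes U: "L1_positive_contraction M U" and u: "u \<in> L1 M"
  shows "AE x in M. L1_rep ((L1_mean M U ^^ l) u) x
    = (\<Sum>j\<le>l. real (l choose j) * L1_rep ((U ^^ j) u) x) / 2 ^ l"
  using u
proof (induction l arbitrary: u)
  case 0
  show ?case by simp
next
  case (Suc l)
  let ?H = "L1_mean M U"
  note Hl = L1_positive_contractionD[OF pc_funpow[OF pc_mean[OF U], of l]]
  note Uu = pc_closed[OF U Suc.prems]
  have eq: "(?H ^^ Suc l) u = L1_scale M (1/2) (L1_add M ((?H ^^ l) u) ((?H ^^ l) (U u)))"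
    by (simp only: funpow_Suc_right o_apply)
      (simp add: L1_mean_def[of M U u] Hl(3,4) Suc.prems Uu L1_closed)
  have shift: "(U ^^ j) (U u) = (U ^^ Suc j) u" for j
    by (simp add: funpow_swap1)
  show ?case
    unfolding eq sum_binomial_Suc
    using AE_rep_scale[OF L1_add_closed[OF Hl(2)[OF Suc.prems] Hl(2)[OF Uu]], of "1/2"]
      AE_rep_add[OF Hl(2)[OF Suc.prems] Hl(2)[OF Uu]] Suc.IH[OF Suc.prems] Suc.IH[OF Uu]
    unfolding shift
    by eventually_elim (simp add: add_divide_distrib)
qed

text \<open>
  Summation by parts turns \<open>(U - I) H\<^sup>2\<^sup>n\<close> into a combination of powers of \<open>U\<close> whose
  coefficients are differences of neighbouring binomial coefficients. As powers of \<open>U\<close> are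
  contractions, the norm is at most the sum of the absolute values of these differences.
\<close>

lemma L1_norm_diff_funpow_mean_le:
  assumes U: "L1_positive_contraction M U" and u: "u \<in> L1 M"
  shows "L1_norm M (L1_diff M (U ((L1_mean M U ^^ (2*n)) u)) ((L1_mean M U ^^ (2*n)) u))
    \<le> 2 * (real (2*n choose n) / 4 ^ n) * L1_norm M u"
proof -
  let ?H = "L1_mean M U ^^ (2*n)" and ?c = "\<lambda>j. real (2*n choose j)"
  let ?x = "\<lambda>j. L1_rep ((U ^^ j) u)"
  let ?g = "\<lambda>y. (?x 0 y + (\<Sum>j\<le>2*n. (?c (Suc j) - ?c j) * ?x (Suc j) y)) / 4 ^ n"
  let ?h = "\<lambda>y. (\<bar>?x 0 y\<bar> + (\<Sum>j\<le>2*n. \<bar>?c (Suc j) - ?c j\<bar> * \<bar>?x (Suc j) y\<bar>)) / 4 ^ n"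
  note Uu = pc_closed[OF U u]
  note Ul = L1_positive_contractionD[OF pc_funpow[OF U]]
  note H = L1_positive_contractionD[OF pc_funpow[OF pc_mean[OF U], of "2*n"]]
  have int: "integrable M (?x j)" for j
    using u by (intro L1_rep_integrable Ul(2))
  have com: "U (?H u) = ?H (U u)"
  proof (rule funpow_commute_on[where S = "L1 M", symmetric])
    show "\<forall>u\<in>L1 M. L1_mean M U u \<in> L1 M" using pc_closed[OF pc_mean[OF U]] by blast
    show "\<forall>u\<in>L1 M. L1_mean M U (U u) = U (L1_mean M U u)"
      using pc_mean_commute[OF U U] by auto
  qed (fact u)
  have shift: "(U ^^ j) (U u) = (U ^^ Suc j) u" for j
    by (simp add: funpow_swap1)
  have AE: "AE y in M. L1_rep (L1_diff M (U (?H u)) (?H u)) y = - ?g y"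
    unfolding com
    using AE_rep_diff[OF H(2)[OF Uu] H(2)[OF u]]
      AE_rep_funpow_mean[OF U u, of "2*n"] AE_rep_funpow_mean[OF U Uu, of "2*n"]
    unfolding shift
  proof eventually_elim
    case (elim y)
    have "L1_rep (L1_diff M (?H (U u)) (?H u)) y
        = - ((\<Sum>j\<le>2*n. ?c j * ?x j y) - (\<Sum>j\<le>2*n. ?c j * ?x (Suc j) y)) / 4 ^ n"
      using elim by (simp add: power_mult diff_divide_distrib)
    also have "\<dots> = - ?g y"
      by (simp only: sum_by_parts[of ?c "\<lambda>j. ?x j y" "2*n"])
        (simp add: binomial_eq_0 add_divide_distrib diff_divide_distrib)
    finally show ?case .
  qed
  have "L1_norm M (L1_diff M (U (?H u)) (?H u)) = (\<integral>y. \<bar>- ?g y\<bar> \<partial>M)"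
    by (rule L1_norm_eqI[OF _ _ AE]) (use int L1_rep_integrable[OF u] in
        \<open>auto intro!: L1_closed u Uu H pc_closed[OF U] simp del: funpow.simps\<close>)
  also have "\<dots> \<le> (\<integral>y. ?h y \<partial>M)"
  proof (rule integral_mono)
    fix y
    have "\<bar>\<Sum>j\<le>2*n. (?c (Suc j) - ?c j) * ?x (Suc j) y\<bar>
        \<le> (\<Sum>j\<le>2*n. \<bar>?c (Suc j) - ?c j\<bar> * \<bar>?x (Suc j) y\<bar>)"
      unfolding abs_mult[symmetric] by (rule sum_abs)
    then show "\<bar>- ?g y\<bar> \<le> ?h y" by (simp add: divide_right_mono)
  qed (use int L1_rep_integrable[OF u] in \<open>auto simp del: funpow.simps\<close>)
  also have "\<dots> = (L1_norm M u + (\<Sum>j\<le>2*n. \<bar>?c (Suc j) - ?c j\<bar> * L1_norm M ((U ^^ Suc j) u))) / 4 ^ n"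
    using int L1_rep_integrable[OF u] by (simp add: L1_norm_def del: funpow.simps)
  also have "\<dots> \<le> (L1_norm M u + (\<Sum>j\<le>2*n. \<bar>?c (Suc j) - ?c j\<bar> * L1_norm M u)) / 4 ^ n"
    by (intro divide_right_mono add_left_mono sum_mono mult_left_mono Ul(7) u) auto
  also have "\<dots> = 2 * (?c n / 4 ^ n) * L1_norm M u"
    unfolding sum_distrib_right[symmetric] sum_abs_diff_binomial by (simp add: algebra_simps)
  finally show ?thesis .
qed

section \<open>Splitting off the common part\<close>

text \<open>
  Every positive \<open>u\<close> has an image \<open>P u\<close> that lies in \<open>H\<close> of the positive cone up to a
  positive remainder \<open>r\<close> of relative size \<open>q\<close>. The bound on \<open>\<parallel>s\<parallel> + \<parallel>r\<parallel>\<close>, rather than on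
  \<open>\<parallel>s\<parallel>\<close> and \<open>\<parallel>r\<parallel>\<close> separately, ensures that the property passes to compositions without a
  growing constant in front of \<open>\<parallel>s\<parallel>\<close>.
\<close>

definition L1_splits ::
  "'a measure \<Rightarrow> ('a L1_elem \<Rightarrow> 'a L1_elem) \<Rightarrow> real \<Rightarrow> ('a L1_elem \<Rightarrow> 'a L1_elem) \<Rightarrow> bool" where
  "L1_splits M H q P \<longleftrightarrow> (\<forall>u\<in>L1 M. L1_nonneg M u \<longrightarrow>
     (\<exists>s\<in>L1 M. \<exists>r\<in>L1 M. L1_nonneg M s \<and> L1_nonneg M r \<and> P u = L1_add M (H s) r \<and>
        L1_norm M s + L1_norm M r \<le> L1_norm M u \<and> L1_norm M r \<le> q * L1_norm M u))"

lemma L1_splitsE: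
  assumes "L1_splits M H q P" "u \<in> L1 M" "L1_nonneg M u"
  obtains s r where "s \<in> L1 M" "r \<in> L1 M" "L1_nonneg M s" "L1_nonneg M r"
    "P u = L1_add M (H s) r" "L1_norm M s + L1_norm M r \<le> L1_norm M u"
    "L1_norm M r \<le> q * L1_norm M u"
  using assms unfolding L1_splits_def by blast

lemma L1_nonneg_diff:
  assumes "u \<in> L1 M" "v \<in> L1 M" "AE x in M. L1_rep v x \<le> L1_rep u x"
  shows "L1_nonneg M (L1_diff M u v)"
  using AE_rep_diff[OF assms(1,2)] assms(3) unfolding L1_nonneg_def by eventually_elim simp

lemma L1_diff_add_cancel:
  assumes "u \<in> L1 M" "v \<in> L1 M"
  shows "L1_add M (L1_diff M u v) v = u"
proof (rule L1_eqI)
  show "AE x in M. L1_rep (L1_add M (L1_diff M u v) v) x = L1_rep u x"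
    using AE_rep_add[OF L1_diff_closed[OF assms] assms(2)] AE_rep_diff[OF assms]
    by eventually_elim simp
qed (use assms in \<open>auto intro!: L1_closed\<close>)

lemma L1_add_assoc:
  assumes "u \<in> L1 M" "v \<in> L1 M" "w \<in> L1 M"
  shows "L1_add M (L1_add M u v) w = L1_add M u (L1_add M v w)"
proof (rule L1_eqI)
  show "AE x in M. L1_rep (L1_add M (L1_add M u v) w) x = L1_rep (L1_add M u (L1_add M v w)) x"
    using AE_rep_add[OF L1_add_closed[OF assms(1,2)] assms(3)] AE_rep_add[OF assms(1,2)]
      AE_rep_add[OF assms(1) L1_add_closed[OF assms(2,3)]] AE_rep_add[OF assms(2,3)]
    by eventually_elim simp
qed (use assms in \<open>auto intro!: L1_closed\<close>)

text \<open>
  Here \<open>s\<close> is the pointwise minimum of \<open>a\<close> and \<open>b\<close>. At each point one of \<open>a - s\<close> and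
  \<open>b - s\<close> vanishes and the other one is \<open>\<bar>a - b\<bar>\<close>, which gives the last equation.
\<close>

lemma L1_common_part:
  assumes a: "a \<in> L1 M" "L1_nonneg M a" and b: "b \<in> L1 M" "L1_nonneg M b"
  obtains s where "s \<in> L1 M" "L1_nonneg M s"
    "L1_nonneg M (L1_diff M a s)" "L1_nonneg M (L1_diff M b s)"
    "L1_norm M a = L1_norm M (L1_diff M a s) + L1_norm M s"
    "L1_norm M b = L1_norm M (L1_diff M b s) + L1_norm M s"
    "L1_norm M (L1_diff M a s) + L1_norm M (L1_diff M b s) = L1_norm M (L1_diff M a b)"
proof -
  let ?s = "\<lambda>x. min (L1_rep a x) (L1_rep b x)"
  define s where "s = L1_class M ?s"
  have i: "integrable M (L1_rep a)" "integrable M (L1_rep b)" "integrable M ?s"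
    using a b by (auto intro: L1_rep_integrable)
  have s: "s \<in> L1 M" unfolding s_def using i by (intro L1_class_in_L1)
  have rep: "AE x in M. L1_rep s x = ?s x"
    unfolding s_def by (rule AE_L1_rep_class[OF i(3)])
  have s0: "L1_nonneg M s"
    using rep a(2) b(2) unfolding L1_nonneg_def by eventually_elim simp
  have "AE x in M. L1_rep s x \<le> L1_rep a x" "AE x in M. L1_rep s x \<le> L1_rep b x"
    using rep by (eventually_elim, simp)+
  then have r0: "L1_nonneg M (L1_diff M a s)" "L1_nonneg M (L1_diff M b s)"
    by (auto intro!: L1_nonneg_diff a b s)
  have na: "L1_norm M a = L1_norm M (L1_diff M a s) + L1_norm M s"
    using L1_norm_add_nonneg[OF L1_diff_closed[OF a(1) s] s r0(1) s0]
    by (simp add: L1_diff_add_cancel a s)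
  have nb: "L1_norm M b = L1_norm M (L1_diff M b s) + L1_norm M s"
    using L1_norm_add_nonneg[OF L1_diff_closed[OF b(1) s] s r0(2) s0]
    by (simp add: L1_diff_add_cancel b s)
  have "L1_norm M (L1_diff M a b) = (\<integral>x. \<bar>L1_rep a x - L1_rep b x\<bar> \<partial>M)"
    by (rule L1_norm_eqI[OF _ _ AE_rep_diff]) (use a b i in \<open>auto intro!: L1_closed\<close>)
  also have "\<dots> = (\<integral>x. (L1_rep a x - ?s x) + (L1_rep b x - ?s x) \<partial>M)"
    by (rule Bochner_Integration.integral_cong) auto
  also have "\<dots> = (\<integral>x. L1_rep a x - ?s x \<partial>M) + (\<integral>x. L1_rep b x - ?s x \<partial>M)"
    using i by (intro Bochner_Integration.integral_add) auto
  also have "(\<integral>x. L1_rep a x - ?s x \<partial>M) = (\<integral>x. \<bar>L1_rep a x - ?s x\<bar> \<partial>M)"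
    by (rule Bochner_Integration.integral_cong) auto
  also have "\<dots> = L1_norm M (L1_diff M a s)"
    by (rule L1_norm_eqI[symmetric])
      (use a s i rep AE_rep_diff[OF a(1) s] in \<open>auto intro!: L1_closed\<close>)
  also have "(\<integral>x. L1_rep b x - ?s x \<partial>M) = (\<integral>x. \<bar>L1_rep b x - ?s x\<bar> \<partial>M)"
    by (rule Bochner_Integration.integral_cong) auto
  also have "\<dots> = L1_norm M (L1_diff M b s)"
    by (rule L1_norm_eqI[symmetric])
      (use b s i rep AE_rep_diff[OF b(1) s] in \<open>auto intro!: L1_closed\<close>)
  finally show ?thesis using that s s0 r0 na nb by simp
qed

text \<open>
  With \<open>a = U (B u)\<close>, \<open>b = B u\<close> and their common part \<open>s\<close>, the element \<open>a\<close> equals both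
  \<open>s + (a - s)\<close> and \<open>U b = U s + U (b - s)\<close>. The mean of the two is \<open>H s + r\<close>, where \<open>r\<close> is
  at most half of \<open>\<parallel>a - s\<parallel> + \<parallel>b - s\<parallel> = \<parallel>a - b\<parallel>\<close> in norm. The same
  bound for \<open>\<parallel>r\<parallel>\<close> gives \<open>\<parallel>s\<parallel> + \<parallel>r\<parallel> \<le> (\<parallel>a\<parallel> + \<parallel>b\<parallel>) / 2 \<le> \<parallel>u\<parallel>\<close>.
\<close>

lemma L1_splits_of_norm_diff:
  assumes U: "L1_positive_contraction M U" and B: "L1_positive_contraction M B"
    and le: "\<And>u. u \<in> L1 M \<Longrightarrow> L1_norm M (L1_diff M (U (B u)) (B u)) \<le> 2 * q * L1_norm M u"
  shows "L1_splits M (L1_mean M U) q (U \<circ> B)"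
  unfolding L1_splits_def
proof (intro ballI impI)
  fix u assume u: "u \<in> L1 M" "L1_nonneg M u"
  note U' = L1_positive_contractionD[OF U] and B' = L1_positive_contractionD[OF B]
  let ?a = "U (B u)" and ?b = "B u"
  have b: "?b \<in> L1 M" "L1_nonneg M ?b" using u by (auto intro: B')
  then have a: "?a \<in> L1 M" "L1_nonneg M ?a" by (auto intro: U')
  obtain s where s: "s \<in> L1 M" "L1_nonneg M s"
    and r0: "L1_nonneg M (L1_diff M ?a s)" "L1_nonneg M (L1_diff M ?b s)"
    and na: "L1_norm M ?a = L1_norm M (L1_diff M ?a s) + L1_norm M s"
    and nb: "L1_norm M ?b = L1_norm M (L1_diff M ?b s) + L1_norm M s"
    and nd: "L1_norm M (L1_diff M ?a s) + L1_norm M (L1_diff M ?b s) = L1_norm M (L1_diff M ?a ?b)"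
    using L1_common_part[OF a b] by blast
  let ?ra = "L1_diff M ?a s" and ?rb = "L1_diff M ?b s"
  define r where "r = L1_scale M (1/2) (L1_add M ?ra (U ?rb))"
  have c: "?ra \<in> L1 M" "?rb \<in> L1 M" "U ?rb \<in> L1 M" "U s \<in> L1 M" "L1_mean M U s \<in> L1 M"
    using a b s U'(2) pc_closed[OF pc_mean[OF U]] by (auto intro!: L1_closed)
  have Urb: "L1_nonneg M (U ?rb)" using c r0 by (intro U')
  have r: "r \<in> L1 M" "L1_nonneg M r"
    unfolding r_def using c r0 Urb by (auto intro!: L1_closed L1_nonneg_scale L1_nonneg_add)
  have "L1_norm M r = (L1_norm M ?ra + L1_norm M (U ?rb)) / 2"
    unfolding r_def using c r0 Urb by (simp add: L1_norm_scale L1_closed L1_norm_add_nonneg)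
  also have "\<dots> \<le> (L1_norm M ?ra + L1_norm M ?rb) / 2"
    using U'(7)[OF c(2)] by simp
  finally have nr: "2 * L1_norm M r \<le> L1_norm M ?ra + L1_norm M ?rb" by simp
  have eq: "?a = L1_add M (L1_mean M U s) r"
  proof (rule L1_eqI)
    have Ueq: "U ?rb = L1_diff M ?a (U s)" using b s by (simp add: U'(5))
    show "AE x in M. L1_rep ?a x = L1_rep (L1_add M (L1_mean M U s) r) x"
      using AE_rep_add[OF c(5) r(1)] AE_rep_mean[where U = U, OF s(1) c(4)]
        AE_rep_scale[OF L1_add_closed[OF c(1,3)], of "1/2"] AE_rep_add[OF c(1,3)]
        AE_rep_diff[OF a(1) s(1)] AE_rep_diff[OF a(1) c(4)]
      unfolding r_def[symmetric] Ueq[symmetric] by eventually_elim (simp add: field_simps)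
  qed (use a c r in \<open>auto intro!: L1_closed\<close>)
  have "L1_norm M ?a \<le> L1_norm M ?b" "L1_norm M ?b \<le> L1_norm M u"
    using U'(7)[OF b(1)] B'(7)[OF u(1)] by auto
  then have "L1_norm M s + L1_norm M r \<le> L1_norm M u"
    using na nb nr by linarith
  moreover have "L1_norm M r \<le> q * L1_norm M u"
    using nr nd le[OF u(1)] by linarith
  ultimately show "\<exists>s\<in>L1 M. \<exists>r\<in>L1 M. L1_nonneg M s \<and> L1_nonneg M r \<and>
      (U \<circ> B) u = L1_add M (L1_mean M U s) r \<and>
      L1_norm M s + L1_norm M r \<le> L1_norm M u \<and> L1_norm M r \<le> q * L1_norm M u"
    using s r eq by auto
qed

text \<open>
  If \<open>P' u = H s + r\<close> and \<open>P r = H s' + r'\<close>, then \<open>P (P' u) = H (P s + s') + r'\<close>: only the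
  remainder is split again, and \<open>P\<close> moves past \<open>H\<close>. The mass balance survives because
  \<open>\<parallel>s'\<parallel> + \<parallel>r'\<parallel> \<le> \<parallel>r\<parallel>\<close>.
\<close>

lemma L1_splits_comp:
  assumes H: "L1_positive_contraction M H" and P: "L1_positive_contraction M P"
    and com: "\<forall>u\<in>L1 M. P (H u) = H (P u)"
    and sp: "L1_splits M H q P" "L1_splits M H q' P'" and q: "0 \<le> q"
  shows "L1_splits M H (q * q') (P \<circ> P')"
  unfolding L1_splits_def
proof (intro ballI impI)
  fix u assume u: "u \<in> L1 M" "L1_nonneg M u"
  note H' = L1_positive_contractionD[OF H] and P' = L1_positive_contractionD[OF P]
  obtain s r where 1: "s \<in> L1 M" "r \<in> L1 M" "L1_nonneg M s" "L1_nonneg M r"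
    "P' u = L1_add M (H s) r" "L1_norm M s + L1_norm M r \<le> L1_norm M u"
    "L1_norm M r \<le> q' * L1_norm M u"
    using L1_splitsE[OF sp(2) u] by blast
  obtain s' r' where 2: "s' \<in> L1 M" "r' \<in> L1 M" "L1_nonneg M s'" "L1_nonneg M r'"
    "P r = L1_add M (H s') r'" "L1_norm M s' + L1_norm M r' \<le> L1_norm M r"
    "L1_norm M r' \<le> q * L1_norm M r"
    using L1_splitsE[OF sp(1) 1(2,4)] by blast
  let ?s = "L1_add M (P s) s'"
  have Ps: "P s \<in> L1 M" "L1_nonneg M (P s)" "L1_norm M (P s) \<le> L1_norm M s"
    using 1 by (auto intro: P')
  have "P (P' u) = L1_add M (H (P s)) (L1_add M (H s') r')"
    using 1 2 com by (simp add: P'(3) H'(2))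
  also have "\<dots> = L1_add M (H ?s) r'"
    using Ps 2 by (simp add: L1_add_assoc H'(2,3))
  finally have eq: "(P \<circ> P') u = L1_add M (H ?s) r'" by simp
  have s: "?s \<in> L1 M" "L1_nonneg M ?s" "L1_norm M ?s = L1_norm M (P s) + L1_norm M s'"
    using Ps 2 by (auto intro: L1_closed L1_nonneg_add L1_norm_add_nonneg)
  have "L1_norm M ?s + L1_norm M r' \<le> L1_norm M u"
    using s Ps 1 2 by linarith
  moreover have "L1_norm M r' \<le> q * q' * L1_norm M u"
    using 2(7) mult_left_mono[OF 1(7) q] by (simp add: mult.assoc)
  ultimately show "\<exists>s\<in>L1 M. \<exists>r\<in>L1 M. L1_nonneg M s \<and> L1_nonneg M r \<and>
      (P \<circ> P') u = L1_add M (H s) r \<and>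
      L1_norm M s + L1_norm M r \<le> L1_norm M u \<and> L1_norm M r \<le> q * q' * L1_norm M u"
    using s 2 eq by blast
qed

lemma L1_splits_funpow:
  assumes H: "L1_positive_contraction M H" and P: "L1_positive_contraction M P"
    and com: "\<forall>u\<in>L1 M. P (H u) = H (P u)"
    and sp: "L1_splits M H q P" and q: "0 \<le> q"
  shows "L1_splits M H (q ^ Suc n) (P ^^ Suc n)"
proof (induction n)
  case 0
  show ?case using sp by simp
next
  case (Suc n)
  have "L1_splits M H (q * q ^ Suc n) (P \<circ> P ^^ Suc n)"
    by (rule L1_splits_comp[OF H P com sp Suc.IH q])
  then show ?case by (simp only: funpow.simps power_Suc)
qed

text \<open>
  In contrast to the preceding lemma, the part to be split again is now the argument \<open>s\<close> of
  \<open>H\<^sup>l\<close>: from \<open>P s = H s' + r'\<close> follows \<open>P (H\<^sup>l s + e) = H\<^sup>l\<^sup>+\<^sup>1 s' + (H\<^sup>l r' + P e)\<close>. Each step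
  gains a factor \<open>H\<close> and adds at most \<open>q \<parallel>u\<parallel>\<close> to the error.
\<close>

lemma funpow_eq_mean_power_plus_error:
  assumes H: "L1_positive_contraction M H" and P: "L1_positive_contraction M P"
    and com: "\<forall>u\<in>L1 M. P (H u) = H (P u)"
    and sp: "L1_splits M H q P" and q: "0 \<le> q"
    and u: "u \<in> L1 M" "L1_nonneg M u"
  shows "\<exists>s\<in>L1 M. \<exists>e\<in>L1 M. L1_nonneg M s \<and> (P ^^ l) u = L1_add M ((H ^^ l) s) e \<and>
    L1_norm M s \<le> L1_norm M u \<and> L1_norm M e \<le> real l * q * L1_norm M u"
proof (induction l)
  case 0
  have "u = L1_add M u (L1_diff M u u)" "L1_norm M (L1_diff M u u) = 0"
  proof -
    note c = L1_diff_closed[OF u(1) u(1)]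
    show "u = L1_add M u (L1_diff M u u)"
    proof (rule L1_eqI)
      show "AE x in M. L1_rep u x = L1_rep (L1_add M u (L1_diff M u u)) x"
        using AE_rep_add[OF u(1) c] AE_rep_diff[OF u(1) u(1)] by eventually_elim simp
    qed (use u in \<open>auto intro!: L1_closed\<close>)
    have "AE x in M. L1_rep (L1_diff M u u) x = 0"
      using AE_rep_diff[OF u(1) u(1)] by eventually_elim simp
    from L1_norm_eqI[OF c _ this] show "L1_norm M (L1_diff M u u) = 0" by simp
  qed
  then show ?case using u L1_diff_closed[OF u(1) u(1)] by (auto intro!: bexI)
next
  case (Suc l)
  note P' = L1_positive_contractionD[OF P]
    and Hl = L1_positive_contractionD[OF pc_funpow[OF H, of l]]
  from Suc.IH obtain s e where 1: "s \<in> L1 M" "e \<in> L1 M" "L1_nonneg M s"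
    "(P ^^ l) u = L1_add M ((H ^^ l) s) e" "L1_norm M s \<le> L1_norm M u"
    "L1_norm M e \<le> real l * q * L1_norm M u"
    by blast
  obtain s' r' where 2: "s' \<in> L1 M" "r' \<in> L1 M" "L1_nonneg M s'" "L1_nonneg M r'"
    "P s = L1_add M (H s') r'" "L1_norm M s' + L1_norm M r' \<le> L1_norm M s"
    "L1_norm M r' \<le> q * L1_norm M s"
    using L1_splitsE[OF sp 1(1,3)] by blast
  let ?e = "L1_add M ((H ^^ l) r') (P e)"
  have c: "H s' \<in> L1 M" "(H ^^ l) r' \<in> L1 M" "P e \<in> L1 M" "(H ^^ l) (H s') \<in> L1 M"
    using 1 2 pc_closed[OF H] by (auto intro: P' Hl)
  have comm: "(H ^^ l) (P s) = P ((H ^^ l) s)"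
    by (rule funpow_commute_on[where S = "L1 M"]) (use com 1 pc_closed[OF H] in auto)
  have "(P ^^ Suc l) u = L1_add M (P ((H ^^ l) s)) (P e)"
    using 1 by (simp add: P'(3) Hl(2))
  also have "\<dots> = L1_add M (L1_add M ((H ^^ l) (H s')) ((H ^^ l) r')) (P e)"
    unfolding comm[symmetric] 2(5) by (simp add: Hl(3) c 2)
  also have "\<dots> = L1_add M ((H ^^ Suc l) s') ?e"
    using c by (simp add: L1_add_assoc funpow_swap1)
  finally have eq: "(P ^^ Suc l) u = L1_add M ((H ^^ Suc l) s') ?e" .
  have "L1_norm M ?e \<le> L1_norm M ((H ^^ l) r') + L1_norm M (P e)"
    by (rule L1_norm_add_le[OF c(2,3)])
  also have "\<dots> \<le> L1_norm M r' + L1_norm M e"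
    by (intro add_mono Hl P' 1 2)
  also have "\<dots> \<le> q * L1_norm M u + real l * q * L1_norm M u"
    by (rule add_mono[OF order_trans[OF 2(7) mult_left_mono[OF 1(5) q]] 1(6)])
  finally have "L1_norm M ?e \<le> real (Suc l) * q * L1_norm M u"
    by (simp add: algebra_simps)
  moreover have "L1_norm M s' \<le> L1_norm M u"
    using 2(6) 1(5) L1_norm_nonneg[of M r'] by linarith
  ultimately show ?case
    using 2 eq L1_add_closed[OF c(2,3)] by blast
qed

section \<open>The zero-two law\<close>

text \<open>
  The law for two commuting positive contractions \<open>U\<close> and \<open>B\<close>. The error \<open>l q\<^sup>n\<close> grows with
  the number \<open>l\<close> of factors \<open>H\<close>, so \<open>l\<close> has to be fixed first, by the decay of the central
  binomial coefficients, and \<open>n\<close> only afterwards.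
\<close>

lemma zero_two_commuting:
  assumes U: "L1_positive_contraction M U" and B: "L1_positive_contraction M B"
    and com: "\<forall>u\<in>L1 M. B (U u) = U (B u)"
    and le: "\<And>u. u \<in> L1 M \<Longrightarrow> L1_norm M (L1_diff M (U (B u)) (B u)) \<le> 2 * q * L1_norm M u"
    and q: "0 \<le> q" "q < 1" and \<epsilon>: "0 < \<epsilon>"
  shows "\<exists>d\<ge>1. \<forall>u\<in>L1 M.
    L1_norm M (L1_diff M (U (((U \<circ> B) ^^ d) u)) (((U \<circ> B) ^^ d) u)) \<le> \<epsilon> * L1_norm M u"
proof -
  let ?H = "L1_mean M U" and ?P = "U \<circ> B"
  note U' = L1_positive_contractionD[OF U]
  note H = pc_mean[OF U] and P = pc_comp[OF U B]
  have "\<forall>\<^sub>F n in sequentially. real (2*n choose n) / 4 ^ n < \<epsilon> / 4"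
    using central_binomial_tendsto_0 by (rule order_tendstoD) (use \<epsilon> in simp)
  then obtain N where N: "\<And>n. n \<ge> N \<Longrightarrow> real (2*n choose n) / 4 ^ n < \<epsilon> / 4"
    by (auto simp: eventually_sequentially)
  \<comment> \<open>even, to have a central coefficient, and nonzero, to make \<open>d\<close> positive\<close>
  define l where "l = 2 * Suc N"
  have l: "l \<ge> 1" "2 * (real (2 * Suc N choose Suc N) / 4 ^ Suc N) \<le> \<epsilon> / 2"
  proof -
    have "2 * x \<le> \<epsilon> / 2" if "x < \<epsilon> / 4" for x using that by simp
    from this[OF N[of "Suc N"]]
    show "2 * (real (2 * Suc N choose Suc N) / 4 ^ Suc N) \<le> \<epsilon> / 2" by simp
  qed (simp add: l_def)
  have "(\<lambda>n. 2 * real l * q ^ n) \<longlonglongrightarrow> 2 * real l * 0"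
    by (intro tendsto_mult_left LIMSEQ_power_zero) (use q in simp)
  then have "(\<lambda>n. 2 * real l * q ^ n) \<longlonglongrightarrow> 0" by simp
  then have "\<forall>\<^sub>F n in sequentially. 2 * real l * q ^ n < \<epsilon> / 2"
    by (rule order_tendstoD) (use \<epsilon> in simp)
  \<comment> \<open>the factor 2 in front of \<open>real l\<close> is the norm bound of \<open>U - I\<close>, applied to the error\<close>
  then obtain n where n: "2 * real l * q ^ Suc n < \<epsilon> / 2"
    unfolding eventually_sequentially using le_SucI by blast
  have comP: "\<forall>u\<in>L1 M. ?P (?H u) = ?H (?P u)"
    by (intro ballI pc_mean_commute[OF P U]) (use com U'(2) in auto)
  let ?Q = "?P ^^ Suc n"
  have Q: "L1_positive_contraction M ?Q" by (rule pc_funpow[OF P])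
  have comQ: "\<forall>u\<in>L1 M. ?Q (?H u) = ?H (?Q u)"
    by (intro ballI funpow_commute_on[where S = "L1 M"]) (use comP pc_closed[OF P] in auto)
  have sp: "L1_splits M ?H (q ^ Suc n) ?Q"
    by (rule L1_splits_funpow[OF H P comP L1_splits_of_norm_diff[OF U B le] q(1)])
  define d where "d = Suc n * l"
  have d: "d \<ge> 1" using l(1) by (simp add: d_def)
  have Qd: "?Q ^^ l = ?P ^^ d" unfolding d_def by (rule funpow_mult)
  let ?D = "\<lambda>u. L1_diff M (U u) u"
  have D: "L1_linear M ?D"
    using L1_linear_opdiff[OF U'(1), of "\<lambda>u. u"] by (simp add: L1_opdiff_def L1_linear_def)
  have "L1_norm M ((?D \<circ> ?P ^^ d) u) \<le> \<epsilon> * L1_norm M u" if "u \<in> L1 M" for u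
  proof (rule L1_norm_le_of_nonneg[OF _ that])
    show "L1_linear M (?D \<circ> ?P ^^ d)"
      by (intro L1_linear_comp D pc_linear[OF pc_funpow[OF P]])
    fix v assume v: "v \<in> L1 M" "L1_nonneg M v"
    obtain s e where s: "s \<in> L1 M" "e \<in> L1 M"
      and eq: "(?P ^^ d) v = L1_add M ((?H ^^ l) s) e" and ns: "L1_norm M s \<le> L1_norm M v"
      and ne: "L1_norm M e \<le> real l * q ^ Suc n * L1_norm M v"
      using funpow_eq_mean_power_plus_error[OF H Q comQ sp zero_le_power[OF q(1)] v, of l]
      unfolding Qd by blast
    let ?h = "(?H ^^ l) s"
    have h: "?h \<in> L1 M" by (rule pc_closed[OF pc_funpow[OF H] s(1)])
    have "L1_norm M ((?D \<circ> ?P ^^ d) v) = L1_norm M (L1_add M (?D ?h) (?D e))"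
      unfolding o_apply eq by (subst L1_linear_add[OF D h s(2)]) (rule refl)
    also have "\<dots> \<le> L1_norm M (?D ?h) + L1_norm M (?D e)"
      by (intro L1_norm_add_le L1_closed U' h s)
    also have "L1_norm M (?D ?h) \<le> \<epsilon> / 2 * L1_norm M v"
    proof -
      have "L1_norm M (?D ?h) \<le> 2 * (real (2 * Suc N choose Suc N) / 4 ^ Suc N) * L1_norm M s"
        unfolding l_def by (rule L1_norm_diff_funpow_mean_le[OF U s(1)])
      also have "\<dots> \<le> \<epsilon> / 2 * L1_norm M v"
        by (rule mult_mono[OF l(2) ns]) (use \<epsilon> in \<open>auto intro: L1_norm_nonneg\<close>)
      finally show ?thesis .
    qed
    also have "L1_norm M (?D e) \<le> \<epsilon> / 2 * L1_norm M v"
    proof -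
      have "L1_norm M (?D e) \<le> 2 * L1_norm M e"
        using L1_norm_diff_le[OF U'(2)[OF s(2)] s(2)] U'(7)[OF s(2)] by linarith
      also have "\<dots> \<le> (2 * real l * q ^ Suc n) * L1_norm M v"
        using ne by (simp add: mult.assoc)
      also have "\<dots> \<le> \<epsilon> / 2 * L1_norm M v"
        by (intro mult_right_mono L1_norm_nonneg less_imp_le n)
      finally show ?thesis .
    qed
    finally show "L1_norm M ((?D \<circ> ?P ^^ d) v) \<le> \<epsilon> * L1_norm M v" by simp
  qed
  with d show ?thesis by auto
qed

theorem theorem3p4:
  fixes M :: "'a measure" and Z T :: "'a L1_elem \<Rightarrow> 'a L1_elem"
    and m k :: nat and \<epsilon> :: real
  assumes "L1_positive_contraction M Z" and "L1_positive_contraction M T"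
    and "\<forall>u\<in>L1 M. T (Z u) = Z (T u)"
    and "k \<ge> 1"
    and "L1_opnorm M (Z \<circ> L1_opdiff M (T ^^ (m + k)) (T ^^ m)) < 2"
    and "\<epsilon> > 0"
  shows "\<exists>d n\<^sub>0. d \<ge> 1 \<and> n\<^sub>0 \<ge> 1 \<and>
    (\<forall>n\<ge>n\<^sub>0. L1_opnorm M ((Z ^^ d) \<circ> L1_opdiff M (T ^^ (n + k)) (T ^^ n)) < ennreal \<epsilon>)"
proof -
  note Z = L1_positive_contractionD[OF assms(1)]
  note Zn = L1_positive_contractionD[OF pc_funpow[OF assms(1)]]
  note Tn = L1_positive_contractionD[OF pc_funpow[OF assms(2)]]
  let ?U = "T ^^ k" and ?B = "Z \<circ> T ^^ m"
  have U: "L1_positive_contraction M ?U" and B: "L1_positive_contraction M ?B"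
    using assms(1,2) by (auto intro: pc_comp pc_funpow)
  have TZ: "(T ^^ i) (Z u) = Z ((T ^^ i) u)" if "u \<in> L1 M" for i u
    by (rule funpow_commute_on[where S = "L1 M"]) (use that assms(3) pc_closed[OF assms(2)] in auto)
  have TZn: "(T ^^ i) ((Z ^^ j) u) = (Z ^^ j) ((T ^^ i) u)" if "u \<in> L1 M" for i j u
    by (rule funpow_commute_on[where S = "L1 M", symmetric])
      (use that TZ Z(2) in auto)
  have Tadd: "(T ^^ i) ((T ^^ j) u) = (T ^^ (i + j)) u" for i j u
    by (simp add: funpow_add)
  have com: "\<forall>u\<in>L1 M. ?B (?U u) = ?U (?B u)"
    by (simp add: TZ Tn(2) Tadd add.commute[of k m])
  define c where "c = enn2real (L1_opnorm M (Z \<circ> L1_opdiff M (T ^^ (m + k)) (T ^^ m)))"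
  have fin: "L1_opnorm M (Z \<circ> L1_opdiff M (T ^^ (m + k)) (T ^^ m)) < top"
    using assms(5) by (rule less_trans) (simp add: less_top)
  have c: "L1_opnorm M (Z \<circ> L1_opdiff M (T ^^ (m + k)) (T ^^ m)) = ennreal c"
    using fin by (simp add: c_def)
  have c0: "0 \<le> c" by (simp add: c_def)
  have "ennreal c < ennreal 2" using assms(5) c by simp
  then have c2: "c < 2" using c0 by (simp add: ennreal_less_iff)
  have le: "L1_norm M (L1_diff M (?U (?B u)) (?B u)) \<le> 2 * (c / 2) * L1_norm M u"
    if u: "u \<in> L1 M" for u
  proof -
    have "L1_linear M (Z \<circ> L1_opdiff M (T ^^ (m + k)) (T ^^ m))"
      by (intro L1_linear_comp L1_linear_opdiff Z Tn)
    from L1_norm_le_of_opnorm_le[OF this _ c0 u] c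
    have "L1_norm M (Z (L1_diff M ((T ^^ (m + k)) u) ((T ^^ m) u))) \<le> c * L1_norm M u"
      by (simp add: L1_opdiff_def)
    moreover have "Z (L1_diff M ((T ^^ (m + k)) u) ((T ^^ m) u)) = L1_diff M (?U (?B u)) (?B u)"
      by (simp add: Z(5) Tn(2) TZ Tadd u add.commute[of k m])
    ultimately show ?thesis by simp
  qed
  obtain d where d: "1 \<le> d" and step: "\<And>u. u \<in> L1 M \<Longrightarrow>
    L1_norm M (L1_diff M (?U (((?U \<circ> ?B) ^^ d) u)) (((?U \<circ> ?B) ^^ d) u)) \<le> \<epsilon> / 2 * L1_norm M u"
  proof -
    have "0 \<le> c / 2" "c / 2 < 1" "0 < \<epsilon> / 2" using c0 c2 assms(6) by auto
    from zero_two_commuting[OF U B com le this] show ?thesis using that by blast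
  qed
  define N where "N = d * (k + m)"
  have P: "((?U \<circ> ?B) ^^ i) u = (Z ^^ i) ((T ^^ (i * (k + m))) u)" if u: "u \<in> L1 M" for i u
  proof (induction i)
    case (Suc i)
    have "((?U \<circ> ?B) ^^ Suc i) u = (T ^^ k) (Z ((T ^^ m) ((Z ^^ i) ((T ^^ (i * (k + m))) u))))"
      by (simp add: Suc.IH)
    also have "\<dots> = Z ((T ^^ k) ((T ^^ m) ((Z ^^ i) ((T ^^ (i * (k + m))) u))))"
      by (rule TZ) (intro Tn Zn u)
    also have "\<dots> = Z ((Z ^^ i) ((T ^^ (k + m)) ((T ^^ (i * (k + m))) u)))"
      by (simp only: TZn[OF Tn(2)[OF u]] Tadd add.assoc)
    also have "\<dots> = (Z ^^ Suc i) ((T ^^ (Suc i * (k + m))) u)"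
      by (simp add: Tadd)
    finally show ?case .
  qed simp
  have N: "N \<ge> 1" using d assms(4) by (simp add: N_def)
  have "L1_opnorm M ((Z ^^ d) \<circ> L1_opdiff M (T ^^ (n + k)) (T ^^ n)) < ennreal \<epsilon>" if n: "n \<ge> N" for n
  proof -
    have "L1_opnorm M ((Z ^^ d) \<circ> L1_opdiff M (T ^^ (n + k)) (T ^^ n)) \<le> ennreal (\<epsilon> / 2)"
    proof (rule L1_opnorm_leI)
      fix u assume u: "u \<in> L1 M"
      let ?g = "(Z ^^ d) ((T ^^ N) u)"
      have g: "?g \<in> L1 M" by (intro Zn Tn u)
      have n1: "(Z ^^ d) ((T ^^ n) u) = (T ^^ (n - N)) ?g"
        using n by (simp add: TZn Tn(2) u Tadd)
      have n2: "(Z ^^ d) ((T ^^ (n + k)) u) = (T ^^ (n - N)) (?U ?g)"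
        using n by (simp add: TZn Tn(2) u Tadd add.commute[of k])
      have "((Z ^^ d) \<circ> L1_opdiff M (T ^^ (n + k)) (T ^^ n)) u
          = L1_diff M ((Z ^^ d) ((T ^^ (n + k)) u)) ((Z ^^ d) ((T ^^ n) u))"
        by (simp add: L1_opdiff_def Zn(5) Tn(2) u)
      also have "\<dots> = (T ^^ (n - N)) (L1_diff M (?U ?g) ?g)"
        unfolding n1 n2 by (simp add: Tn(5) Tn(2) g)
      finally have "L1_norm M (((Z ^^ d) \<circ> L1_opdiff M (T ^^ (n + k)) (T ^^ n)) u)
          = L1_norm M ((T ^^ (n - N)) (L1_diff M (?U ?g) ?g))" by simp
      also have "\<dots> \<le> L1_norm M (L1_diff M (?U ?g) ?g)"
        by (intro Tn L1_closed g)
      also have "\<dots> \<le> \<epsilon> / 2 * L1_norm M u"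
        using step[OF u] by (simp add: P[OF u] N_def)
      finally show "L1_norm M (((Z ^^ d) \<circ> L1_opdiff M (T ^^ (n + k)) (T ^^ n)) u)
          \<le> \<epsilon> / 2 * L1_norm M u" .
    qed (use assms(6) in simp)
    also have "\<dots> < ennreal \<epsilon>" using assms(6) by (simp add: ennreal_less_iff)
    finally show ?thesis .
  qed
  then show ?thesis using d N by blast
qed

end
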